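(* Let $k$ be a positive integer and $\boldsymbol\beta$ a $k$-tuple of skew shapes whose shifted contents lie in $\{1,\dots,N\}$. Then the new variant combinatorial LLT polynomial satisfies $\mathcal G_{\boldsymbol\beta}(\mathbf x;q)=\sum_{t\ge0}q^tF_{\Gamma_k(\boldsymbol\beta,t)}(\mathbf x)$.
   Context: Skew shapes are drawn in English convention inside $\mathbb Z_{\ge1}\times\mathbb Z_{\ge1}$; content of cell $(a,b)$ is $b-a$; for $\boldsymbol\beta=\boldsymbol\mu/\boldsymbol\nu=(\beta^{(0)},\dots,\beta^{(k-1)})$ the shifted content of $z\in\beta^{(r)}$ is $c(z)k+r$. $\mathcal U=\mathbb Z\langle u_1,\dots,u_N\rangle$ acts on the right on $\mathbb Z\mathbb Y^k$ ($\mathbb Y$ = Young diagrams): $u_{ck+r}$ ($0\le r<k$) adds a cell of content $c$ to the $r$-th diagram if this gives a diagram, and gives $0$ otherwise. $W^{(k)}(\boldsymbol\beta)=\{\mathsf v:\boldsymbol\nu\cdot u_{\mathsf v_1}\cdots u_{\mathsf v_n}=\boldsymbol\mu\}$; $\mathrm{inv}_k(\mathsf v)=|\{(i,j):i<j,0<\mathsf v_i-\mathsf v_j<k\}|$. $\mathcal G_{\boldsymbol\beta}(\mathbf x;q)=\sum_{\mathsf v\in W^{(k)}(\boldsymbol\beta)}q^{\mathrm{inv}_k(\mathsf v)}Q_{\mathrm{Des}(\mathsf v)}(\mathbf x)$, where $\mathrm{Des}(\mathsf v)=\{i:\mathsf v_i>\mathsf v_{i+1}\}$ and $Q_D$ is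 Gessel's fundamental quasisymmetric function. $\Gamma_k(\boldsymbol\beta,t)$ is the unique Assaf switchboard of level $k$ with vertex set $\{\mathsf v\in W^{(k)}(\boldsymbol\beta):\mathrm{inv}_k(\mathsf v)=t\}$ (an Assaf switchboard of level $k$: edge-labeled graph on nonzero $k$-words of a fixed length $n$, labels in $\{2,\dots,n-1\}$, each $i$-edge a switch in positions $i-1,i,i+1$ of the form $\{bac,bca\}$ or $\{acb,cab\}$ with $a<b<c$, $c-a>k$, or $\{bac,acb\}$ or $\{bca,cab\}$ with $a<b<c$, $c-a\le k$, every vertex with exactly one descent among positions $i-1,i$ lying on exactly one $i$-edge). For a switchboard $\Gamma$, $F_\Gamma=\sum_{\mathsf w\in V(\Gamma)}Q_{\mathrm{Des}(\mathsf w)}$. *)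

theory Defs
  imports "HOL-Computational_Algebra.Polynomial"
begin

(* Young diagrams in English convention inside Z_{>=1} x Z_{>=1}: finite sets of cells (row, column) *)
definition young :: "(nat \<times> nat) set \<Rightarrow> bool" where
  "young D \<longleftrightarrow> finite D \<and>
     (\<forall>(a,b)\<in>D. 1 \<le> a \<and> 1 \<le> b \<and>
        (\<forall>a' b'. 1 \<le> a' \<and> a' \<le> a \<and> 1 \<le> b' \<and> b' \<le> b \<longrightarrow> (a',b') \<in> D))"

definition content :: "nat \<times> nat \<Rightarrow> int" where
  "content z = int (snd z) - int (fst z)"

(* one step of the right action of u_m on k-tuples of Young diagrams (lists of length k):
   m = c*k + r with 0 <= r < k; u_m adds a cell of content c to the r-th diagram,
   provided the result is a diagram (otherwise the result is 0, i.e. no step exists) *)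
definition act_step :: "nat \<Rightarrow> (nat \<times> nat) set list \<Rightarrow> nat \<Rightarrow> (nat \<times> nat) set list \<Rightarrow> bool" where
  "act_step k lam m lam' \<longleftrightarrow>
     (\<exists>z. z \<notin> lam ! (m mod k) \<and> content z = int (m div k) \<and>
          young (insert z (lam ! (m mod k))) \<and>
          lam' = lam[m mod k := insert z (lam ! (m mod k))])"

definition Wk :: "nat \<Rightarrow> nat \<Rightarrow> (nat \<times> nat) set list \<Rightarrow> (nat \<times> nat) set list \<Rightarrow> nat list set" where
  "Wk k N mu nu = {v. set v \<subseteq> {1..N} \<and>
     (\<exists>lams. length lams = length v + 1 \<and> lams ! 0 = nu \<and> lams ! (length v) = mu \<and>
        (\<forall>i<length v. act_step k (lams ! i) (v ! i) (lams ! (i+1))))}"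

definition inv_k :: "nat \<Rightarrow> nat list \<Rightarrow> nat" where
  "inv_k k v = card {(i,j). i < j \<and> j < length v \<and> v ! j < v ! i \<and> v ! i < v ! j + k}"

(* descent set, positions 1-based: Des(v) = {i : v_i > v_{i+1}} *)
definition Des :: "nat list \<Rightarrow> nat set" where
  "Des v = {i. 1 \<le> i \<and> i < length v \<and> v ! i < v ! (i - 1)}"

(* Formal power series in x_1, x_2, ... with integer coefficients are represented by their
   coefficient function on monomials x^alpha (alpha : nat => nat, alpha i = exponent of x_i). *)

definition gessel_Q :: "nat \<Rightarrow> nat set \<Rightarrow> (nat \<Rightarrow> nat) \<Rightarrow> int" where
  "gessel_Q n D alpha = int (card {s. length s = n \<and> (\<forall>j<n. 1 \<le> s ! j) \<and>
      (\<forall>j. 1 \<le> j \<and> j < n \<longrightarrow> s ! (j - 1) \<le> s ! j \<and> (j \<in> D \<longrightarrow> s ! (j - 1) < s ! j)) \<and>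
      (\<forall>x. count_list s x = alpha x)})"

definition LLT_G :: "nat \<Rightarrow> nat \<Rightarrow> (nat \<times> nat) set list \<Rightarrow> (nat \<times> nat) set list \<Rightarrow> (nat \<Rightarrow> nat) \<Rightarrow> int poly" where
  "LLT_G k N mu nu alpha = (\<Sum>v\<in>Wk k N mu nu. monom (gessel_Q (length v) (Des v) alpha) (inv_k k v))"

(* switches: triples in positions i-1,i,i+1 (1-based) *)
definition trip :: "nat list \<Rightarrow> nat \<Rightarrow> nat list" where
  "trip w i = [w ! (i - 2), w ! (i - 1), w ! i]"

definition is_switch :: "nat \<Rightarrow> nat \<Rightarrow> nat list \<Rightarrow> nat list \<Rightarrow> bool" where
  "is_switch k i w w' \<longleftrightarrow> length w = length w' \<and> 2 \<le> i \<and> i + 1 \<le> length w \<and>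
     (\<forall>j<length w. j \<notin> {i - 2, i - 1, i} \<longrightarrow> w ! j = w' ! j) \<and>
     (\<exists>a b c. a < b \<and> b < c \<and>
        ((c - a > k \<and> ({trip w i, trip w' i} = {[b,a,c],[b,c,a]} \<or> {trip w i, trip w' i} = {[a,c,b],[c,a,b]})) \<or>
         (c - a \<le> k \<and> ({trip w i, trip w' i} = {[b,a,c],[a,c,b]} \<or> {trip w i, trip w' i} = {[b,c,a],[c,a,b]}))))"

(* exactly one descent among positions i-1, i (1-based) *)
definition one_descent :: "nat list \<Rightarrow> nat \<Rightarrow> bool" where
  "one_descent w i \<longleftrightarrow> ((w ! (i - 1) < w ! (i - 2)) \<noteq> (w ! i < w ! (i - 1)))"

(* A switchboard is a pair (V, E); an i-edge is (i, {w, w'}). *)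
type_synonym switchboard = "nat list set \<times> (nat \<times> nat list set) set"

definition assaf_switchboard_n :: "nat \<Rightarrow> nat \<Rightarrow> switchboard \<Rightarrow> bool" where
  "assaf_switchboard_n k n G \<longleftrightarrow>
     (\<forall>w\<in>fst G. length w = n \<and> (\<forall>x\<in>set w. x \<noteq> 0)) \<and>
     (\<forall>(i,e)\<in>snd G. 2 \<le> i \<and> i \<le> n - 1 \<and>
        (\<exists>w w'. e = {w, w'} \<and> w \<in> fst G \<and> w' \<in> fst G \<and> is_switch k i w w')) \<and>
     (\<forall>w\<in>fst G. \<forall>i. 2 \<le> i \<and> i \<le> n - 1 \<and> one_descent w i \<longrightarrow>
        (\<exists>!e. (i,e) \<in> snd G \<and> w \<in> e))"

definition assaf_switchboard :: "nat \<Rightarrow> switchboard \<Rightarrow> bool" where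
  "assaf_switchboard k G \<longleftrightarrow> (\<exists>n. assaf_switchboard_n k n G)"

definition Gamma_k :: "nat \<Rightarrow> nat \<Rightarrow> (nat \<times> nat) set list \<Rightarrow> (nat \<times> nat) set list \<Rightarrow> nat \<Rightarrow> switchboard" where
  "Gamma_k k N mu nu t = (THE G. assaf_switchboard k G \<and> fst G = {v \<in> Wk k N mu nu. inv_k k v = t})"

definition F_sb :: "switchboard \<Rightarrow> (nat \<Rightarrow> nat) \<Rightarrow> int" where
  "F_sb G alpha = (\<Sum>w\<in>fst G. gessel_Q (length w) (Des w) alpha)"

end

theory Submission
  imports Defs "HOL-Library.Multiset"
begin

text \<open>The coefficient of \<open>q^t\<close> in \<open>G\<^sub>\<beta>(x;q)\<close> is \<open>F\<^sub>V\<close> for the set \<open>V\<close> of words of \<open>W^(k)(\<beta>)\<close> with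
  \<open>inv\<^sub>k = t\<close>, so it suffices that \<open>V\<close> carries a unique Assaf switchboard. A switch is
  determined by its position and one endpoint, so the only candidate joins each \<open>w \<in> V\<close> to its
  switch at every window with exactly one descent, and this is a switchboard as soon as \<open>V\<close> is
  closed under these switches. Two cells of equal content cannot be added to a diagram within
  two steps, so the three letters in every window of a word of \<open>W^(k)(\<beta>)\<close> are distinct and a
  window with one descent is switchable. A switch is a product of at most two transpositions of
  adjacent letters \<open>u\<^sub>x u\<^sub>y\<close> that commute (they act on different diagrams, or on diagonals at
  distance at least 2), so it stays in \<open>W^(k)(\<beta>)\<close>; it also preserves \<open>inv\<^sub>k\<close>.\<close>

section \<open>Words acting on tuples of Young diagrams\<close>

fun reaches :: "nat \<Rightarrow> (nat \<times> nat) set list \<Rightarrow> nat list \<Rightarrow> (nat \<times> nat) set list \<Rightarrow> bool" where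
  "reaches k L [] L' \<longleftrightarrow> L' = L"
| "reaches k L (x # v) L' \<longleftrightarrow> (\<exists>L1. act_step k L x L1 \<and> reaches k L1 v L')"

lemma reaches_append: "reaches k L (u @ v) L' \<longleftrightarrow> (\<exists>M. reaches k L u M \<and> reaches k M v L')"
  by (induction u arbitrary: L) auto

lemma reaches_iff_chain:
  "reaches k L v L' \<longleftrightarrow>
   (\<exists>lams. length lams = length v + 1 \<and> lams ! 0 = L \<and> lams ! length v = L' \<and>
      (\<forall>i<length v. act_step k (lams ! i) (v ! i) (lams ! (i + 1))))"
proof (induction v arbitrary: L)
  case Nil
  then show ?case
    by (auto intro!: exI[of _ "[L]"])
next
  case (Cons x v)
  show ?case
  proof
    assume "reaches k L (x # v) L'"
    then obtain L1 where step: "act_step k L x L1" and "reaches k L1 v L'"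
      by auto
    then obtain lams where lams: "length lams = length v + 1" "lams ! 0 = L1" "lams ! length v = L'"
      "\<forall>i<length v. act_step k (lams ! i) (v ! i) (lams ! (i + 1))"
      using Cons.IH by blast
    show "\<exists>lams. length lams = length (x # v) + 1 \<and> lams ! 0 = L \<and> lams ! length (x # v) = L' \<and>
      (\<forall>i<length (x # v). act_step k (lams ! i) ((x # v) ! i) (lams ! (i + 1)))"
      using lams step by (intro exI[of _ "L # lams"]) (auto simp: nth_Cons split: nat.splits)
  next
    assume "\<exists>lams. length lams = length (x # v) + 1 \<and> lams ! 0 = L \<and> lams ! length (x # v) = L' \<and>
      (\<forall>i<length (x # v). act_step k (lams ! i) ((x # v) ! i) (lams ! (i + 1)))"
    then obtain lams where lams: "length lams = length v + 2" "lams ! 0 = L" "lams ! length (x # v) = L'"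
      "\<forall>i<length (x # v). act_step k (lams ! i) ((x # v) ! i) (lams ! (i + 1))"
      by auto
    have "act_step k L x (lams ! 1)"
      using lams(2,4) by (metis One_nat_def add_0 length_Cons nth_Cons_0 zero_less_Suc)
    moreover have "reaches k (lams ! 1) v L'"
      unfolding Cons.IH using lams by (intro exI[of _ "tl lams"]) (auto simp: nth_tl)
    ultimately show "reaches k L (x # v) L'"
      by auto
  qed
qed

lemma Wk_iff_reaches: "v \<in> Wk k N mu nu \<longleftrightarrow> set v \<subseteq> {1..N} \<and> reaches k nu v mu"
  unfolding Wk_def reaches_iff_chain by simp

definition young_tuple :: "nat \<Rightarrow> (nat \<times> nat) set list \<Rightarrow> bool" where
  "young_tuple k L \<longleftrightarrow> length L = k \<and> (\<forall>r<k. young (L ! r))"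

definition total_cells :: "(nat \<times> nat) set list \<Rightarrow> nat" where
  "total_cells L = sum_list (map card L)"

lemma young_finite: "young D \<Longrightarrow> finite D"
  by (simp add: young_def)

lemma young_down_closed:
  "young D \<Longrightarrow> (a, b) \<in> D \<Longrightarrow> 1 \<le> a' \<Longrightarrow> a' \<le> a \<Longrightarrow> 1 \<le> b' \<Longrightarrow> b' \<le> b \<Longrightarrow> (a', b') \<in> D"
  unfolding young_def by blast

lemma young_pos: "young D \<Longrightarrow> (a, b) \<in> D \<Longrightarrow> 1 \<le> a \<and> 1 \<le> b"
  unfolding young_def by blast

lemma act_stepE:
  assumes "act_step k L m L'"
  obtains z where "z \<notin> L ! (m mod k)" "content z = int (m div k)"
    "young (insert z (L ! (m mod k)))" "L' = L[m mod k := insert z (L ! (m mod k))]"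
  using assms unfolding act_step_def by blast

lemma young_tuple_act_step: "0 < k \<Longrightarrow> young_tuple k L \<Longrightarrow> act_step k L m L' \<Longrightarrow> young_tuple k L'"
  by (elim act_stepE) (auto simp: young_tuple_def nth_list_update)

lemma sum_list_list_update_nat:
  "i < length xs \<Longrightarrow> sum_list (xs[i := x]) + xs ! i = sum_list xs + (x :: nat)"
proof (induction xs arbitrary: i)
  case (Cons a xs)
  then show ?case
    by (cases i) auto
qed simp

lemma total_cells_act_step:
  assumes k: "0 < k" and L: "young_tuple k L" and step: "act_step k L m L'"
  shows "total_cells L' = Suc (total_cells L)"
  using step
proof (rule act_stepE)
  fix z assume z: "z \<notin> L ! (m mod k)" and L': "L' = L[m mod k := insert z (L ! (m mod k))]"
  have r: "m mod k < length L"
    using k L by (simp add: young_tuple_def)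
  have "finite (L ! (m mod k))"
    using k L by (auto simp: young_tuple_def intro: young_finite)
  moreover have "total_cells L' + card (L ! (m mod k)) = total_cells L + card (insert z (L ! (m mod k)))"
    unfolding total_cells_def L' map_update using sum_list_list_update_nat[of "m mod k" "map card L"] r
    by simp
  ultimately show ?thesis
    using z by simp
qed

lemma reaches_young_tuple:
  "reaches k L v L' \<Longrightarrow> 0 < k \<Longrightarrow> young_tuple k L \<Longrightarrow>
   young_tuple k L' \<and> total_cells L' = total_cells L + length v"
proof (induction v arbitrary: L)
  case (Cons x v)
  then obtain L1 where "act_step k L x L1" "reaches k L1 v L'"
    by auto
  with Cons young_tuple_act_step[of k L x L1] total_cells_act_step[of k L x L1] show ?case
    by auto
qed simp

text \<open>The next cell on the diagonal of \<open>z\<close> needs both its upper and its left neighbour,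
  and at most one of them can have been added after \<open>z\<close>.\<close>

lemma young_no_same_content_after_two:
  assumes D: "young D" and zD: "z \<notin> D" and Dz: "young (insert z D)"
    and z'_notin: "z' \<notin> insert y (insert z D)" and D3: "young (insert z' (insert y (insert z D)))"
    and same: "content z' = content z"
  shows False
proof -
  obtain a b where z: "z = (a, b)" by force
  obtain a' b' where z': "z' = (a', b')" by force
  have diag: "int b - int a = int b' - int a'"
    using same by (simp add: content_def z z')
  have pos: "1 \<le> a" "1 \<le> b"
    using young_pos[OF Dz, of a b] z by auto
  have pos': "1 \<le> a'" "1 \<le> b'"
    using young_pos[OF D3, of a' b'] z' by auto
  consider "a' = a" | "a' < a" | "a < a'"
    by linarith
  then show False
  proof cases
    case 1
    then show False
      using diag z z' z'_notin by auto
  next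
    case 2
    have "(a', b') \<in> insert z D"
      by (rule young_down_closed[OF Dz, of a b]) (use z 2 diag pos' in auto)
    then show False
      using z' z'_notin by auto
  next
    case 3
    have "(a, b + 1) \<in> insert z' (insert y (insert z D))" "(a + 1, b) \<in> insert z' (insert y (insert z D))"
      by (rule young_down_closed[OF D3, of a' b']; use z' 3 diag pos in auto)+
    then have "(a, b + 1) \<in> D \<or> (a + 1, b) \<in> D"
      using z z' 3 diag by auto
    then have "(a, b) \<in> D"
      using young_down_closed[OF D] pos by (metis le_add1 order_refl)
    then show False
      using zD z by simp
  qed
qed

lemma act_step_not_repeated:
  assumes k: "0 < k" and L: "young_tuple k L" and step: "act_step k L x L1"
  shows "\<not> act_step k L1 x L2"
proof
  assume step': "act_step k L1 x L2"
  let ?r = "x mod k"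
  obtain z where z: "z \<notin> L ! ?r" "content z = int (x div k)" "young (insert z (L ! ?r))"
    "L1 = L[?r := insert z (L ! ?r)]"
    using step by (rule act_stepE)
  obtain z' where z': "z' \<notin> L1 ! ?r" "content z' = int (x div k)" "young (insert z' (L1 ! ?r))"
    using step' by (rule act_stepE)
  have "young (L ! ?r)" "L1 ! ?r = insert z (L ! ?r)"
    using L k z(4) by (simp_all add: young_tuple_def)
  then show False
    using young_no_same_content_after_two[of "L ! ?r" z z' z] z z' by (simp add: insert_absorb)
qed

lemma act_step_not_repeated_after_one:
  assumes k: "0 < k" and L: "young_tuple k L"
    and step1: "act_step k L x L1" and step2: "act_step k L1 y L2"
  shows "\<not> act_step k L2 x L3"
proof
  assume step3: "act_step k L2 x L3"
  let ?r = "x mod k"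
  have D: "young (L ! ?r)" and r: "?r < length L"
    using L k by (simp_all add: young_tuple_def)
  obtain z where z: "z \<notin> L ! ?r" "content z = int (x div k)" "young (insert z (L ! ?r))"
    "L1 = L[?r := insert z (L ! ?r)]"
    using step1 by (rule act_stepE)
  obtain z2 where z2: "z2 \<notin> L1 ! (y mod k)" "young (insert z2 (L1 ! (y mod k)))"
    "L2 = L1[y mod k := insert z2 (L1 ! (y mod k))]"
    using step2 by (rule act_stepE)
  obtain z' where z': "z' \<notin> L2 ! ?r" "content z' = int (x div k)" "young (insert z' (L2 ! ?r))"
    using step3 by (rule act_stepE)
  have L1r: "L1 ! ?r = insert z (L ! ?r)"
    using z(4) r by simp
  show False
  proof (cases "y mod k = ?r")
    case True
    then have "L2 ! ?r = insert z2 (insert z (L ! ?r))"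
      using z2(3) L1r r z(4) by simp
    then show ?thesis
      using young_no_same_content_after_two[OF D z(1) z(3), of z' z2] z z' z2 L1r True by simp
  next
    case False
    then have "L2 ! ?r = insert z (L ! ?r)"
      using z2(3) L1r by simp
    then show ?thesis
      using young_no_same_content_after_two[OF D z(1) z(3), of z' z] z z' by (simp add: insert_absorb)
  qed
qed

lemma drop_window:
  "i + 3 \<le> length w \<Longrightarrow> drop i w = w ! i # w ! (i + 1) # w ! (i + 2) # drop (i + 3) w"
  by (simp add: Cons_nth_drop_Suc numeral_3_eq_3)

lemma reaches_window_distinct:
  assumes k: "0 < k" and L: "young_tuple k L" and reach: "reaches k L w L'" and i: "i + 3 \<le> length w"
  shows "w ! i \<noteq> w ! (i + 1) \<and> w ! (i + 1) \<noteq> w ! (i + 2) \<and> w ! i \<noteq> w ! (i + 2)"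
proof -
  have "reaches k L (take i w @ w ! i # w ! (i + 1) # w ! (i + 2) # drop (i + 3) w) L'"
    using reach drop_window[OF i] by (metis append_take_drop_id)
  then obtain M where M: "reaches k L (take i w) M"
    and "reaches k M (w ! i # w ! (i + 1) # w ! (i + 2) # drop (i + 3) w) L'"
    unfolding reaches_append by blast
  then obtain M1 M2 M3 where steps: "act_step k M (w ! i) M1" "act_step k M1 (w ! (i + 1)) M2"
    "act_step k M2 (w ! (i + 2)) M3"
    by auto
  have "young_tuple k M"
    using reaches_young_tuple[OF M k L] by blast
  moreover from this have "young_tuple k M1"
    using young_tuple_act_step[OF k _ steps(1)] by blast
  ultimately show ?thesis
    using act_step_not_repeated[OF k] act_step_not_repeated_after_one[OF k] steps by metis
qed

text \<open>The lower or the right neighbour of \<open>z\<close> is still weakly north-west of \<open>z2\<close> and differs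
  from \<open>z2\<close>, so it lies in \<open>D\<close>, and then so does \<open>z\<close>.\<close>

lemma young_insert_not_north_west:
  assumes D: "young D" and zD: "z \<notin> D" and D2: "young (insert z2 (insert z D))"
    and far: "content z2 \<notin> {content z - 1, content z, content z + 1}"
    and z: "z = (a', b')" and z2: "z2 = (a, b)" and le: "a' \<le> a" "b' \<le> b"
  shows False
proof -
  have neq: "(a', b') \<noteq> (a, b)"
    using far z z2 by auto
  have pos: "1 \<le> a'" "1 \<le> b'"
    using young_pos[OF D2, of a' b'] z by auto
  have "(a' + 1, b') \<in> D \<or> (a', b' + 1) \<in> D"
  proof (cases "a' < a")
    case True
    then have "(a' + 1, b') \<in> insert z2 (insert z D)"
      using young_down_closed[OF D2, of a b] z2 pos le by auto
    moreover have "(a' + 1, b') \<noteq> z2"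
      using far z z2 by (auto simp: content_def)
    ultimately show ?thesis
      using z by auto
  next
    case False
    then have "b' < b"
      using neq le by auto
    then have "(a', b' + 1) \<in> insert z2 (insert z D)"
      using young_down_closed[OF D2, of a b] z2 pos le by auto
    moreover have "(a', b' + 1) \<noteq> z2"
      using far z z2 by (auto simp: content_def)
    ultimately show ?thesis
      using z by auto
  qed
  then have "(a', b') \<in> D"
    using young_down_closed[OF D] pos by (metis le_add1 order_refl)
  then show False
    using z zD by simp
qed

lemma young_insert_remove:
  assumes D: "young D" and zD: "z \<notin> D" and D2: "young (insert z2 (insert z D))"
    and far: "content z2 \<notin> {content z - 1, content z, content z + 1}"
  shows "young (insert z2 D)"
  unfolding young_def
proof (intro conjI ballI)
  show "finite (insert z2 D)"
    using young_finite[OF D] by simp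
next
  fix c assume c_in: "c \<in> insert z2 D"
  obtain a b where c: "c = (a, b)" by force
  have pos: "1 \<le> a \<and> 1 \<le> b"
    using young_pos[OF D2, of a b] c_in c by auto
  have "(a', b') \<in> insert z2 D" if le: "1 \<le> a' \<and> a' \<le> a \<and> 1 \<le> b' \<and> b' \<le> b" for a' b'
  proof (cases "c \<in> D")
    case True
    then show ?thesis
      using young_down_closed[OF D, of a b a' b'] le c by auto
  next
    case False
    then have "c = z2"
      using c_in by auto
    then have "(a', b') \<in> insert z2 (insert z D)" "(a', b') \<noteq> z"
      using young_down_closed[OF D2, of a b a' b'] le c
        young_insert_not_north_west[OF D zD D2 far, of a' b' a b] by auto
    then show ?thesis
      by auto
  qed
  then show "case c of (a, b) \<Rightarrow> 1 \<le> a \<and> 1 \<le> b \<and>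
      (\<forall>a' b'. 1 \<le> a' \<and> a' \<le> a \<and> 1 \<le> b' \<and> b' \<le> b \<longrightarrow> (a', b') \<in> insert z2 D)"
    using pos c by simp
qed

definition commuting_letters :: "nat \<Rightarrow> nat \<Rightarrow> nat \<Rightarrow> bool" where
  "commuting_letters k x y \<longleftrightarrow> x mod k \<noteq> y mod k \<or> 2 \<le> \<bar>int (x div k) - int (y div k)\<bar>"

lemma act_step_commute:
  assumes k: "0 < k" and L: "young_tuple k L"
    and step1: "act_step k L x L1" and step2: "act_step k L1 y L2" and xy: "commuting_letters k x y"
  shows "\<exists>M. act_step k L y M \<and> act_step k M x L2"
proof -
  let ?r = "x mod k" and ?s = "y mod k"
  have r: "?r < length L" "?s < length L"
    using k L by (auto simp: young_tuple_def)
  obtain z where z: "z \<notin> L ! ?r" "content z = int (x div k)" "young (insert z (L ! ?r))"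
    "L1 = L[?r := insert z (L ! ?r)]"
    using step1 by (rule act_stepE)
  obtain z2 where z2: "z2 \<notin> L1 ! ?s" "content z2 = int (y div k)" "young (insert z2 (L1 ! ?s))"
    "L2 = L1[?s := insert z2 (L1 ! ?s)]"
    using step2 by (rule act_stepE)
  show ?thesis
  proof (cases "?r = ?s")
    case False
    have L1s: "L1 ! ?s = L ! ?s"
      using z(4) False by simp
    let ?M = "L[?s := insert z2 (L ! ?s)]"
    have "act_step k L y ?M"
      unfolding act_step_def by (rule exI[of _ z2]) (use z2 L1s in auto)
    moreover have "act_step k ?M x L2"
      unfolding act_step_def
      by (rule exI[of _ z]) (use z z2 L1s False r in \<open>auto intro: list_update_swap\<close>)
    ultimately show ?thesis
      by blast
  next
    case True
    have D: "young (L ! ?r)"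
      using L k by (simp add: young_tuple_def)
    have L1s: "L1 ! ?s = insert z (L ! ?r)"
      using z(4) r True by simp
    have far: "2 \<le> \<bar>content z - content z2\<bar>"
      using xy True z z2 by (simp add: commuting_letters_def)
    then have "content z2 \<notin> {content z - 1, content z, content z + 1}"
      by auto
    then have Dz2: "young (insert z2 (L ! ?r))"
      using young_insert_remove[OF D z(1), of z2] z2 L1s by simp
    let ?M = "L[?r := insert z2 (L ! ?r)]"
    have "act_step k L y ?M"
      unfolding act_step_def by (rule exI[of _ z2]) (use z2 L1s Dz2 True in auto)
    moreover have "act_step k ?M x L2"
      unfolding act_step_def
      by (rule exI[of _ z]) (use z z2 L1s True r far Dz2 in \<open>auto simp: insert_commute\<close>)
    ultimately show ?thesis
      by blast
  qed
qed

lemma commuting_letters_near: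
  assumes "0 < k" "x < y" "y < x + k"
  shows "commuting_letters k x y"
proof -
  have "x mod k \<noteq> y mod k"
  proof
    assume "x mod k = y mod k"
    then have "k dvd y - x"
      using assms mod_eq_dvd_iff_nat[of x y k] by simp
    then show False
      using assms dvd_imp_le[of k "y - x"] by simp
  qed
  then show ?thesis
    by (simp add: commuting_letters_def)
qed

lemma commuting_letters_far:
  assumes "0 < k" "x + k < y"
  shows "commuting_letters k x y"
proof (rule ccontr)
  assume "\<not> commuting_letters k x y"
  then have "x mod k = y mod k" "y div k \<le> x div k + 1"
    by (auto simp: commuting_letters_def)
  moreover have "k * (y div k) \<le> k * (x div k) + k" if "y div k \<le> x div k + 1"
    using that mult_le_mono2[of "y div k" "x div k + 1" k] by simp
  moreover have "y = k * (y div k) + y mod k" "x = k * (x div k) + x mod k"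
    by simp_all
  ultimately show False
    using assms by linarith
qed

lemma commuting_letters_sym: "commuting_letters k x y \<Longrightarrow> commuting_letters k y x"
  unfolding commuting_letters_def by auto

lemma reaches_swap_first:
  assumes "0 < k" "young_tuple k L" "commuting_letters k x y" "reaches k L (x # y # v) L'"
  shows "reaches k L (y # x # v) L'"
proof -
  from assms(4) obtain L1 L2 where "act_step k L x L1" "act_step k L1 y L2" "reaches k L2 v L'"
    by auto
  with act_step_commute[OF assms(1,2)] assms(3) obtain M where "act_step k L y M" "act_step k M x L2"
    by blast
  with \<open>reaches k L2 v L'\<close> show ?thesis
    by auto
qed

lemma reaches_swap_second:
  assumes "0 < k" "young_tuple k L" "commuting_letters k y z" "reaches k L (x # y # z # v) L'"
  shows "reaches k L (x # z # y # v) L'"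
proof -
  from assms(4) obtain L1 where L1: "act_step k L x L1" "reaches k L1 (y # z # v) L'"
    by auto
  then have "reaches k L1 (z # y # v) L'"
    using reaches_swap_first[OF assms(1) _ assms(3)] young_tuple_act_step[OF assms(1,2)] by blast
  with L1 show ?thesis
    by auto
qed

section \<open>Switching a triple of letters\<close>

definition switchable :: "nat list \<Rightarrow> bool" where
  "switchable T \<longleftrightarrow> (\<exists>p q r. T = [p, q, r] \<and> distinct T \<and> (q < p) \<noteq> (r < q))"

fun switch_triple :: "nat \<Rightarrow> nat list \<Rightarrow> nat list" where
  "switch_triple k [p, q, r] =
    (if q < p \<and> p < r then (if r - q > k then [p, r, q] else [q, r, p])
     else if r < p \<and> p < q then (if q - r > k then [p, r, q] else [q, r, p])
     else if p < r \<and> r < q then (if q - p > k then [q, p, r] else [r, p, q])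
     else if q < r \<and> r < p then (if p - q > k then [q, p, r] else [r, p, q])
     else [p, q, r])"
| "switch_triple k T = T"

lemma switchable_iff:
  "switchable T \<longleftrightarrow> (\<exists>p q r. T = [p, q, r] \<and>
     (q < p \<and> p < r \<or> r < p \<and> p < q \<or> p < r \<and> r < q \<or> q < r \<and> r < p))"
  unfolding switchable_def by (rule ex_cong1)+ auto

lemma mset_switch_triple: "mset (switch_triple k T) = mset T"
  by (induction k T rule: switch_triple.induct) (auto simp: add_mset_commute)

lemma length_switch_triple: "length (switch_triple k T) = length T"
  using mset_switch_triple by (metis size_mset)

lemma reaches_rotate_left:
  assumes "0 < k" "young_tuple k L" "commuting_letters k x y" "commuting_letters k x z"
    and "reaches k L (x # y # z # v) L'"
  shows "reaches k L (y # z # x # v) L'"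
  using reaches_swap_second[OF assms(1,2,4) reaches_swap_first[OF assms(1,2,3,5)]] .

lemma reaches_rotate_right:
  assumes "0 < k" "young_tuple k L" "commuting_letters k x z" "commuting_letters k y z"
    and "reaches k L (x # y # z # v) L'"
  shows "reaches k L (z # x # y # v) L'"
  using reaches_swap_first[OF assms(1,2,3) reaches_swap_second[OF assms(1,2,4,5)]] .

text \<open>A switch either transposes two adjacent letters more than \<open>k\<close> apart, or moves an outer
  letter across the other two, each of which lies strictly within distance \<open>k\<close> of it.\<close>

lemma reaches_switch_triple:
  assumes k: "0 < k" and L: "young_tuple k L" and T: "switchable T" and reach: "reaches k L (T @ v) L'"
  shows "reaches k L (switch_triple k T @ v) L'"
proof -
  obtain p q r where T_eq: "T = [p, q, r]"
    and cases: "q < p \<and> p < r \<or> r < p \<and> p < q \<or> p < r \<and> r < q \<or> q < r \<and> r < p"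
    using T unfolding switchable_iff by blast
  have R: "reaches k L (p # q # r # v) L'"
    using reach T_eq by simp
  note swap1 = reaches_swap_first[OF k L _ R] and swap2 = reaches_swap_second[OF k L _ R]
  note rotl = reaches_rotate_left[OF k L _ _ R] and rotr = reaches_rotate_right[OF k L _ _ R]
  note comm = commuting_letters_near[OF k] commuting_letters_far[OF k] commuting_letters_sym
  from cases show ?thesis
  proof (elim disjE conjE)
    assume "q < p" "p < r"
    then show ?thesis
      using T_eq swap2 rotl comm by (cases "k < r - q") auto
  next
    assume "r < p" "p < q"
    then show ?thesis
      using T_eq swap2 rotl comm by (cases "k < q - r") auto
  next
    assume "p < r" "r < q"
    then show ?thesis
      using T_eq swap1 rotr comm by (cases "k < q - p") auto
  next
    assume "q < r" "r < p"
    then show ?thesis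
      using T_eq swap1 rotr comm by (cases "k < p - q") auto
  qed
qed

definition switch_pattern :: "nat \<Rightarrow> nat list \<Rightarrow> nat list \<Rightarrow> bool" where
  "switch_pattern k T T' \<longleftrightarrow> (\<exists>a b c. a < b \<and> b < c \<and>
     ((c - a > k \<and> ({T, T'} = {[b, a, c], [b, c, a]} \<or> {T, T'} = {[a, c, b], [c, a, b]})) \<or>
      (c - a \<le> k \<and> ({T, T'} = {[b, a, c], [a, c, b]} \<or> {T, T'} = {[b, c, a], [c, a, b]}))))"

lemma switch_pattern_iff: "switch_pattern k T T' \<longleftrightarrow> switchable T \<and> T' = switch_triple k T"
proof
  assume "switch_pattern k T T'"
  then obtain a b c where abc: "a < b" "b < c"
    and "(c - a > k \<and> ({T, T'} = {[b, a, c], [b, c, a]} \<or> {T, T'} = {[a, c, b], [c, a, b]})) \<or>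
      (c - a \<le> k \<and> ({T, T'} = {[b, a, c], [a, c, b]} \<or> {T, T'} = {[b, c, a], [c, a, b]}))"
    unfolding switch_pattern_def by blast
  then show "switchable T \<and> T' = switch_triple k T"
    by (elim disjE conjE) (auto simp: doubleton_eq_iff switchable_iff)
next
  assume "switchable T \<and> T' = switch_triple k T"
  then obtain p q r where T: "T = [p, q, r]" and T': "T' = switch_triple k T"
    and "q < p \<and> p < r \<or> r < p \<and> p < q \<or> p < r \<and> r < q \<or> q < r \<and> r < p"
    unfolding switchable_iff by blast
  then consider "q < p \<and> p < r" | "r < p \<and> p < q" | "p < r \<and> r < q" | "q < r \<and> r < p"
    by blast
  then show "switch_pattern k T T'"
  proof cases
    case 1
    then show ?thesis
      unfolding switch_pattern_def T T' by (intro exI[of _ q] exI[of _ p] exI[of _ r]) auto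
  next
    case 2
    then show ?thesis
      unfolding switch_pattern_def T T' by (intro exI[of _ r] exI[of _ p] exI[of _ q]) auto
  next
    case 3
    then show ?thesis
      unfolding switch_pattern_def T T' by (intro exI[of _ p] exI[of _ r] exI[of _ q]) auto
  next
    case 4
    then show ?thesis
      unfolding switch_pattern_def T T' by (intro exI[of _ q] exI[of _ r] exI[of _ p]) auto
  qed
qed

section \<open>The statistic \<open>inv\<^sub>k\<close>\<close>

lemma inv_k_Nil: "inv_k k [] = 0"
  by (simp add: inv_k_def)

lemma inv_k_pairs_Cons:
  "{(i, j). i < j \<and> j < length (x # xs) \<and> (x # xs) ! j < (x # xs) ! i \<and> (x # xs) ! i < (x # xs) ! j + k}
   = (\<lambda>j. (0, Suc j)) ` {j. j < length xs \<and> xs ! j < x \<and> x < xs ! j + k}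
     \<union> (\<lambda>(i, j). (Suc i, Suc j)) ` {(i, j). i < j \<and> j < length xs \<and> xs ! j < xs ! i \<and> xs ! i < xs ! j + k}"
  (is "?L = ?A \<union> ?B")
proof
  show "?L \<subseteq> ?A \<union> ?B"
  proof
    fix p assume "p \<in> ?L"
    then obtain i j where p: "p = (i, j)" "i < j" "j < Suc (length xs)"
      "(x # xs) ! j < (x # xs) ! i" "(x # xs) ! i < (x # xs) ! j + k"
      by auto
    then obtain j' where j: "j = Suc j'"
      by (cases j) auto
    show "p \<in> ?A \<union> ?B"
    proof (cases i)
      case 0
      then show ?thesis
        using p j by auto
    next
      case (Suc i')
      then show ?thesis
        using p j by (auto intro: image_eqI[of _ _ "(i', j')"])
    qed
  qed
  show "?A \<union> ?B \<subseteq> ?L"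
    by auto
qed

lemma inv_k_Cons: "inv_k k (x # xs) = length (filter (\<lambda>y. y < x \<and> x < y + k) xs) + inv_k k xs"
proof -
  have fin: "finite {(i, j). i < j \<and> j < length xs \<and> xs ! j < xs ! i \<and> xs ! i < xs ! j + k}"
    by (rule finite_subset[of _ "{..<length xs} \<times> {..<length xs}"]) auto
  have "inv_k k (x # xs) = card ((\<lambda>j. (0::nat, Suc j)) ` {j. j < length xs \<and> xs ! j < x \<and> x < xs ! j + k})
     + card ((\<lambda>(i, j). (Suc i, Suc j)) ` {(i, j). i < j \<and> j < length xs \<and> xs ! j < xs ! i \<and> xs ! i < xs ! j + k})"
    unfolding inv_k_def inv_k_pairs_Cons by (rule card_Un_disjoint) (use fin in auto)
  also have "\<dots> = card {j. j < length xs \<and> xs ! j < x \<and> x < xs ! j + k} + inv_k k xs"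
    unfolding inv_k_def by (subst card_image, simp add: inj_on_def)+ simp
  finally show ?thesis
    by (simp add: length_filter_conv_card)
qed

lemma inv_k_append:
  "inv_k k (xs @ ys) = inv_k k xs + inv_k k ys + (\<Sum>x\<leftarrow>xs. length (filter (\<lambda>y. y < x \<and> x < y + k) ys))"
  by (induction xs) (auto simp: inv_k_Nil inv_k_Cons)

lemma inv_k_replace_infix:
  assumes "mset T = mset T'" "inv_k k T = inv_k k T'"
  shows "inv_k k (u @ T @ s) = inv_k k (u @ T' @ s)"
proof -
  have "length (filter P T) = length (filter P T')" for P
    by (metis assms(1) mset_filter size_mset)
  then have filter_eq: "length (filter P (T @ s)) = length (filter P (T' @ s))" for P
    by simp
  have "sum_list (map f T) = sum_list (map f T')" for f :: "nat \<Rightarrow> nat"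
    by (metis assms(1) mset_map sum_mset_sum_list)
  then have "inv_k k (T @ s) = inv_k k (T' @ s)"
    unfolding inv_k_append using assms(2) by presburger
  then show ?thesis
    by (simp only: inv_k_append[of k u] filter_eq)
qed

lemma inv_k_switch_triple: "switchable T \<Longrightarrow> inv_k k (switch_triple k T) = inv_k k T"
  unfolding switchable_iff by (elim exE conjE disjE) (auto simp: inv_k_Cons inv_k_Nil)

definition switch_at :: "nat \<Rightarrow> nat list \<Rightarrow> nat \<Rightarrow> nat list" where
  "switch_at k w i = take (i - 2) w @ switch_triple k (trip w i) @ drop (i + 1) w"

lemma length_trip: "length (trip w i) = 3"
  by (simp add: trip_def)

lemma take_trip_drop:
  assumes "2 \<le> i" "i + 1 \<le> length w"
  shows "take (i - 2) w @ trip w i @ drop (i + 1) w = w"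
proof -
  obtain m where i: "i = Suc (Suc m)"
    using assms(1) by (metis add_2_eq_Suc le_Suc_ex)
  have "trip w i @ drop (i + 1) w = drop m w"
    using drop_window[of m w] assms(2) by (simp add: i trip_def numeral_3_eq_3)
  then show ?thesis
    by (simp add: i)
qed

lemma nth_trip:
  assumes "2 \<le> i" "i - 2 \<le> j" "j \<le> i"
  shows "trip w i ! (j + 2 - i) = w ! j"
proof -
  have "j = i - 2 \<or> j = i - 1 \<or> j = i"
    using assms by linarith
  then show ?thesis
    using assms(1) by (auto simp: trip_def numeral_2_eq_2 Suc_diff_Suc)
qed

lemma length_switch_at: "2 \<le> i \<Longrightarrow> i + 1 \<le> length w \<Longrightarrow> length (switch_at k w i) = length w"
  by (simp add: switch_at_def length_switch_triple length_trip)

lemma nth_switch_at: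
  assumes "2 \<le> i" "i + 1 \<le> length w" "j < length w"
  shows "switch_at k w i ! j = (if j < i - 2 \<or> i < j then w ! j else switch_triple k (trip w i) ! (j + 2 - i))"
  using assms by (auto simp: switch_at_def nth_append length_switch_triple length_trip)

lemma trip_switch_at:
  assumes "2 \<le> i" "i + 1 \<le> length w"
  shows "trip (switch_at k w i) i = switch_triple k (trip w i)"
proof -
  have "trip (switch_at k w i) i ! n = switch_triple k (trip w i) ! n" if "n < 3" for n
  proof -
    define j where "j = n + i - 2"
    have j: "i - 2 \<le> j" "j \<le> i" "j < length w" "j + 2 - i = n"
      using that assms unfolding j_def by linarith+
    show ?thesis
      using nth_trip[OF assms(1) j(1,2), of "switch_at k w i"] nth_switch_at[OF assms j(3), of k] j by auto
  qed
  then show ?thesis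
    by (intro nth_equalityI) (simp_all add: length_trip length_switch_triple)
qed

lemma is_switchD:
  assumes sw: "is_switch k i w w'"
  shows "2 \<le> i \<and> i + 1 \<le> length w \<and> switchable (trip w i) \<and> w' = switch_at k w i"
proof -
  have i: "2 \<le> i" "i + 1 \<le> length w" and len: "length w' = length w"
    and outside: "\<forall>j<length w. j \<notin> {i - 2, i - 1, i} \<longrightarrow> w ! j = w' ! j"
    and "switch_pattern k (trip w i) (trip w' i)"
    using sw unfolding is_switch_def switch_pattern_def by auto
  then have T: "switchable (trip w i)" and T': "trip w' i = switch_triple k (trip w i)"
    by (simp_all add: switch_pattern_iff)
  have "w' ! j = switch_at k w i ! j" if "j < length w" for j
  proof (cases "j < i - 2 \<or> i < j")
    case True
    then show ?thesis
      using outside nth_switch_at[OF i that] that by auto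
  next
    case False
    then show ?thesis
      using nth_trip[of i j w'] nth_switch_at[OF i that] T' i by simp
  qed
  then have "w' = switch_at k w i"
    by (intro nth_equalityI) (simp_all add: len length_switch_at[OF i])
  with i T show ?thesis
    by blast
qed

lemma is_switch_switch_at:
  assumes i: "2 \<le> i" "i + 1 \<le> length w" and T: "switchable (trip w i)"
  shows "is_switch k i w (switch_at k w i)"
proof -
  have "switch_pattern k (trip w i) (trip (switch_at k w i) i)"
    using T by (simp add: switch_pattern_iff trip_switch_at[OF i])
  moreover have "\<forall>j<length w. j \<notin> {i - 2, i - 1, i} \<longrightarrow> w ! j = switch_at k w i ! j"
    using nth_switch_at[OF i] by auto
  ultimately show ?thesis
    unfolding is_switch_def switch_pattern_def using i length_switch_at[OF i] by auto
qed

lemma is_switch_iff: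
  "is_switch k i w w' \<longleftrightarrow> 2 \<le> i \<and> i + 1 \<le> length w \<and> switchable (trip w i) \<and> w' = switch_at k w i"
  using is_switchD is_switch_switch_at by blast

lemma is_switch_commute: "is_switch k i w w' \<longleftrightarrow> is_switch k i w' w"
  unfolding is_switch_def by (auto simp: insert_commute)

lemma switch_at_switch_at:
  assumes "2 \<le> i" "i + 1 \<le> length w" "switchable (trip w i)"
  shows "switch_at k (switch_at k w i) i = w"
  using assms is_switch_iff[of k i w "switch_at k w i"] is_switch_iff[of k i "switch_at k w i" w]
    is_switch_commute by metis

lemma switchable_trip_iff: "switchable (trip w i) \<longleftrightarrow> distinct (trip w i) \<and> one_descent w i"
  by (auto simp: switchable_def trip_def one_descent_def)

lemma set_switch_at: "2 \<le> i \<Longrightarrow> i + 1 \<le> length w \<Longrightarrow> set (switch_at k w i) = set w"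
  using take_trip_drop[of i w] mset_switch_triple[of k "trip w i"]
  by (metis set_append set_mset_mset switch_at_def)

lemma reaches_switch_at:
  assumes k: "0 < k" and L: "young_tuple k L" and i: "2 \<le> i" "i + 1 \<le> length w"
    and T: "switchable (trip w i)" and reach: "reaches k L w L'"
  shows "reaches k L (switch_at k w i) L'"
proof -
  obtain M where M: "reaches k L (take (i - 2) w) M" "reaches k M (trip w i @ drop (i + 1) w) L'"
    using reach take_trip_drop[OF i] reaches_append by metis
  have "young_tuple k M"
    using reaches_young_tuple[OF M(1) k L] by blast
  then have "reaches k M (switch_triple k (trip w i) @ drop (i + 1) w) L'"
    using reaches_switch_triple[OF k _ T M(2)] by blast
  then show ?thesis
    unfolding switch_at_def reaches_append using M(1) by blast
qed

lemma inv_k_switch_at: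
  assumes "2 \<le> i" "i + 1 \<le> length w" "switchable (trip w i)"
  shows "inv_k k (switch_at k w i) = inv_k k w"
  using inv_k_replace_infix[of "trip w i" "switch_triple k (trip w i)" k "take (i - 2) w" "drop (i + 1) w"]
    mset_switch_triple inv_k_switch_triple[OF assms(3)] take_trip_drop[OF assms(1,2)]
  by (simp add: switch_at_def)

section \<open>Assaf switchboards on switch-closed vertex sets\<close>

definition switch_edges :: "nat \<Rightarrow> nat \<Rightarrow> nat list set \<Rightarrow> (nat \<times> nat list set) set" where
  "switch_edges k n V = {(i, {w, switch_at k w i}) | w i. w \<in> V \<and> 2 \<le> i \<and> i \<le> n - 1 \<and> one_descent w i}"

lemma assaf_switchboard_n_vertices:
  "assaf_switchboard_n k n G \<Longrightarrow> \<forall>w\<in>fst G. length w = n \<and> (\<forall>x\<in>set w. x \<noteq> 0)"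
  unfolding assaf_switchboard_n_def by (elim conjE)

lemma assaf_switchboard_n_edges:
  "assaf_switchboard_n k n G \<Longrightarrow> \<forall>(i, e)\<in>snd G. 2 \<le> i \<and> i \<le> n - 1 \<and>
      (\<exists>w w'. e = {w, w'} \<and> w \<in> fst G \<and> w' \<in> fst G \<and> is_switch k i w w')"
  unfolding assaf_switchboard_n_def by (elim conjE)

lemma assaf_switchboard_n_ex1_edge:
  "assaf_switchboard_n k n G \<Longrightarrow>
    \<forall>w\<in>fst G. \<forall>i. 2 \<le> i \<and> i \<le> n - 1 \<and> one_descent w i \<longrightarrow> (\<exists>!e. (i, e) \<in> snd G \<and> w \<in> e)"
  unfolding assaf_switchboard_n_def by (elim conjE)

lemma assaf_switchboard_n_edge:
  assumes G: "assaf_switchboard_n k n G" and edge: "(i, e) \<in> snd G" and w: "w \<in> e"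
  shows "e = {w, switch_at k w i} \<and> w \<in> fst G \<and> 2 \<le> i \<and> i \<le> n - 1 \<and> one_descent w i"
proof -
  obtain a b where ab: "e = {a, b}" "a \<in> fst G" "b \<in> fst G" "is_switch k i a b" and i: "2 \<le> i" "i \<le> n - 1"
    using bspec[OF assaf_switchboard_n_edges[OF G] edge] by auto
  define w' where "w' = (if w = a then b else a)"
  have e: "e = {w, w'}" and sw: "is_switch k i w w'"
    using ab w is_switch_commute unfolding w'_def by auto
  then have "switchable (trip w i)" "w' = switch_at k w i"
    using is_switch_iff by blast+
  then show ?thesis
    using ab w e i switchable_trip_iff by auto
qed

lemma assaf_switchboard_n_no_vertices:
  assumes G: "assaf_switchboard_n k n G" and "fst G = {}"
  shows "snd G = {}"
proof (rule equals0I)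
  fix p assume p: "p \<in> snd G"
  obtain i e where "p = (i, e)"
    by fastforce
  then show False
    using bspec[OF assaf_switchboard_n_edges[OF G] p] assms(2) by auto
qed

lemma assaf_switchboard_n_switch_edges:
  assumes V: "\<forall>w\<in>V. length w = n \<and> 0 \<notin> set w"
    and closed: "\<And>w i. w \<in> V \<Longrightarrow> 2 \<le> i \<Longrightarrow> i + 1 \<le> n \<Longrightarrow> one_descent w i \<Longrightarrow>
      switchable (trip w i) \<and> switch_at k w i \<in> V"
  shows "assaf_switchboard_n k n (V, switch_edges k n V)"
  unfolding assaf_switchboard_n_def
proof (intro conjI ballI allI impI)
  fix w assume "w \<in> fst (V, switch_edges k n V)"
  then show "length w = n" "x \<in> set w \<Longrightarrow> x \<noteq> 0" for x
    using V by auto (metis gr0I)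
next
  fix p assume "p \<in> snd (V, switch_edges k n V)"
  then obtain w i where p: "p = (i, {w, switch_at k w i})" "w \<in> V" "2 \<le> i" "i \<le> n - 1" "one_descent w i"
    unfolding switch_edges_def by auto
  moreover have "i + 1 \<le> length w"
    using p V by auto
  ultimately show "case p of (i, e) \<Rightarrow> 2 \<le> i \<and> i \<le> n - 1 \<and>
      (\<exists>w w'. e = {w, w'} \<and> w \<in> fst (V, switch_edges k n V) \<and> w' \<in> fst (V, switch_edges k n V) \<and>
        is_switch k i w w')"
    using closed[of w i] V is_switch_iff by auto
next
  fix w i assume w: "w \<in> fst (V, switch_edges k n V)" and i: "2 \<le> i \<and> i \<le> n - 1 \<and> one_descent w i"
  show "\<exists>!e. (i, e) \<in> snd (V, switch_edges k n V) \<and> w \<in> e"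
  proof (rule ex1I[of _ "{w, switch_at k w i}"])
    show "(i, {w, switch_at k w i}) \<in> snd (V, switch_edges k n V) \<and> w \<in> {w, switch_at k w i}"
      unfolding switch_edges_def using w i by auto
  next
    fix e assume "(i, e) \<in> snd (V, switch_edges k n V) \<and> w \<in> e"
    then obtain x where x: "e = {x, switch_at k x i}" "x \<in> V" "one_descent x i" and "w \<in> e"
      unfolding switch_edges_def by auto
    moreover have "i + 1 \<le> length x" "switchable (trip x i)"
      using x V i closed[of x i] by auto
    ultimately show "e = {w, switch_at k w i}"
      using i switch_at_switch_at[of i x k] by auto
  qed
qed

lemma assaf_switchboard_switch_edges_unique:
  assumes V: "\<forall>w\<in>V. length w = n \<and> 0 \<notin> set w"
    and G: "assaf_switchboard k G" and GV: "fst G = V"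
  shows "G = (V, switch_edges k n V)"
proof -
  obtain n' where G': "assaf_switchboard_n k n' G"
    using G unfolding assaf_switchboard_def by blast
  text \<open>Without vertices the word length \<open>n'\<close> of \<open>G\<close> is unconstrained.\<close>
  have "snd G = switch_edges k n V"
  proof (cases "V = {}")
    case True
    then show ?thesis
      using assaf_switchboard_n_no_vertices[OF G'] GV by (simp add: switch_edges_def)
  next
    case False
    then have n': "n' = n"
      using assaf_switchboard_n_vertices[OF G'] GV V by auto
    show ?thesis
    proof
      show "snd G \<subseteq> switch_edges k n V"
      proof
        fix p assume p: "p \<in> snd G"
        obtain i e where ie: "p = (i, e)"
          by fastforce
        then obtain a b where "e = {a, b}"
          using bspec[OF assaf_switchboard_n_edges[OF G'] p] by auto
        then show "p \<in> switch_edges k n V"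
          using assaf_switchboard_n_edge[OF G', of i e a] p ie GV n'
          unfolding switch_edges_def by auto
      qed
    next
      show "switch_edges k n V \<subseteq> snd G"
      proof
        fix p assume "p \<in> switch_edges k n V"
        then obtain w i where p: "p = (i, {w, switch_at k w i})" "w \<in> V" "2 \<le> i" "i \<le> n - 1" "one_descent w i"
          unfolding switch_edges_def by auto
        then obtain e where "(i, e) \<in> snd G" "w \<in> e"
          using assaf_switchboard_n_ex1_edge[OF G'] GV n' by blast
        then show "p \<in> snd G"
          using assaf_switchboard_n_edge[OF G'] p by metis
      qed
    qed
  qed
  then show ?thesis
    using GV by (metis prod.collapse)
qed

lemma fst_THE_assaf_switchboard:
  assumes V: "\<forall>w\<in>V. length w = n \<and> 0 \<notin> set w"
    and closed: "\<And>w i. w \<in> V \<Longrightarrow> 2 \<le> i \<Longrightarrow> i + 1 \<le> n \<Longrightarrow> one_descent w i \<Longrightarrow>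
      switchable (trip w i) \<and> switch_at k w i \<in> V"
  shows "fst (THE G. assaf_switchboard k G \<and> fst G = V) = V"
proof -
  have "\<exists>!G. assaf_switchboard k G \<and> fst G = V"
    using assaf_switchboard_n_switch_edges[OF V closed] assaf_switchboard_switch_edges_unique[OF V]
    unfolding assaf_switchboard_def by (intro ex1I[of _ "(V, switch_edges k n V)"]) auto
  then show ?thesis
    by (rule conjunct2[OF theI'])
qed

section \<open>The words of \<open>W^(k)(\<beta>)\<close>\<close>

lemma length_Wk:
  "0 < k \<Longrightarrow> young_tuple k nu \<Longrightarrow> v \<in> Wk k N mu nu \<Longrightarrow> length v = total_cells mu - total_cells nu"
  using reaches_young_tuple by (fastforce simp: Wk_iff_reaches)

lemma finite_Wk:
  assumes "0 < k" "young_tuple k nu"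
  shows "finite (Wk k N mu nu)"
proof (rule finite_subset)
  show "Wk k N mu nu \<subseteq> {v. set v \<subseteq> {1..N} \<and> length v = total_cells mu - total_cells nu}"
    using length_Wk[OF assms] Wk_iff_reaches by blast
qed (simp add: finite_lists_length_eq)

lemma Wk_switchable:
  assumes k: "0 < k" and nu: "young_tuple k nu" and v: "v \<in> Wk k N mu nu"
    and i: "2 \<le> i" "i + 1 \<le> length v" and desc: "one_descent v i"
  shows "switchable (trip v i)"
proof -
  obtain m where m: "i = m + 2"
    using i(1) by (metis le_add_diff_inverse2)
  have "distinct (trip v i)"
    using reaches_window_distinct[OF k nu _, of v mu m] v i m by (auto simp: Wk_iff_reaches trip_def)
  then show ?thesis
    using desc switchable_trip_iff by blast
qed

lemma switch_at_in_Wk: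
  assumes "0 < k" "young_tuple k nu" "v \<in> Wk k N mu nu"
    and "2 \<le> i" "i + 1 \<le> length v" "switchable (trip v i)"
  shows "switch_at k v i \<in> Wk k N mu nu"
  using assms set_switch_at reaches_switch_at by (simp add: Wk_iff_reaches)

lemma fst_Gamma_k:
  assumes k: "0 < k" and nu: "young_tuple k nu"
  shows "fst (Gamma_k k N mu nu t) = {v \<in> Wk k N mu nu. inv_k k v = t}"
  unfolding Gamma_k_def
proof (rule fst_THE_assaf_switchboard)
  show "\<forall>w\<in>{v \<in> Wk k N mu nu. inv_k k v = t}. length w = total_cells mu - total_cells nu \<and> 0 \<notin> set w"
    using length_Wk[OF k nu] by (auto simp: Wk_iff_reaches)
next
  fix w i assume w: "w \<in> {v \<in> Wk k N mu nu. inv_k k v = t}" and i: "2 \<le> i"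
    "i + 1 \<le> total_cells mu - total_cells nu" and "one_descent w i"
  then have "switchable (trip w i)" "i + 1 \<le> length w"
    using Wk_switchable[OF k nu] length_Wk[OF k nu] by auto
  then show "switchable (trip w i) \<and> switch_at k w i \<in> {v \<in> Wk k N mu nu. inv_k k v = t}"
    using w i switch_at_in_Wk[OF k nu] inv_k_switch_at by auto
qed

lemma coeff_LLT_G:
  assumes "finite (Wk k N mu nu)"
  shows "coeff (LLT_G k N mu nu alpha) t = (\<Sum>v\<in>{v \<in> Wk k N mu nu. inv_k k v = t}. gessel_Q (length v) (Des v) alpha)"
proof -
  have "coeff (LLT_G k N mu nu alpha) t =
      (\<Sum>v\<in>Wk k N mu nu. if inv_k k v = t then gessel_Q (length v) (Des v) alpha else 0)"
    unfolding LLT_G_def coeff_sum by (intro sum.cong) auto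
  also have "\<dots> = (\<Sum>v\<in>{v \<in> Wk k N mu nu. inv_k k v = t}. gessel_Q (length v) (Des v) alpha)"
    by (rule sum.inter_filter[OF assms, symmetric])
  finally show ?thesis .
qed

theorem corollary4p16:
  fixes k N :: nat and mu nu :: "(nat \<times> nat) set list"
  assumes "0 < k" and "length mu = k" and "length nu = k"
    and "\<forall>r<k. young (mu ! r) \<and> young (nu ! r) \<and> nu ! r \<subseteq> mu ! r"
    and "\<forall>r<k. \<forall>z\<in>mu ! r - nu ! r. 1 \<le> content z * int k + int r \<and> content z * int k + int r \<le> int N"
  shows "\<forall>alpha t. coeff (LLT_G k N mu nu alpha) t = F_sb (Gamma_k k N mu nu t) alpha"
proof (intro allI)
  fix alpha t
  have nu: "young_tuple k nu"
    using assms(3,4) by (simp add: young_tuple_def)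
  show "coeff (LLT_G k N mu nu alpha) t = F_sb (Gamma_k k N mu nu t) alpha"
    unfolding F_sb_def fst_Gamma_k[OF assms(1) nu] coeff_LLT_G[OF finite_Wk[OF assms(1) nu]] ..
qed

end
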